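(* Let $\mathcal{X}=\overline{([x_1,x_2],0)}$ and $\mathcal{Y}=\overline{([y_1,y_2],0)}$ be in $\overline{\mathbb{IR}}^{+}$ with $\dfrac{x_1}{x_2}<\dfrac{y_1}{y_2}$. There is a unique pair $(\mathcal{Z},\mathcal{R})$ in $\overline{\mathbb{IR}}^{+}$ such that $\mathcal{Y}=\mathcal{X}\bullet\mathcal{Z}+\mathcal{R}$, with $l(\mathcal{R})=0$ and $c(\mathcal{R})$ minimal. This pair is given by $$\mathcal{Z}=\frac{y_2-y_1}{x_2-x_1}\,\overline{([1,1],0)},\qquad \mathcal{R}=\frac{x_2y_1-x_1y_2}{x_2-x_1}\,\overline{([1,1],0)}.$$
   Context: $\mathbb{IR}$ is the set of closed bounded intervals $[a,b]$ of $\mathbb{R}$, $a\le b$, with $0=[0,0]$ and addition $[a,b]+[c,d]=[a+c,b+d]$. $\overline{\mathbb{IR}}$ is the quotient of $\mathbb{IR}\times\mathbb{IR}$ by $(x,y)\sim(z,t)\iff x+t=y+z$, with classes $\overline{(x,y)}$ and addition $\overline{(x,y)}+\overline{(z,t)}=\overline{(x+z,y+t)}$. For $\alpha\ge0$, $\alpha\,\overline{([a,b],0)}=\overline{([\alpha a,\alpha b],0)}$. $\overline{\mathbb{IR}}^{+}$ is the subset of elements $\overline{(X,0)}$ with $X=[x_1,x_2]\in\mathbb{IR}$ and $0\le x_1$. For $\overline{([a,b],0)}$, the length is $l=b-a$ and the center is $c=\frac{a+b}{2}$. The product $\bullet$ on elements of $\overline{\mathbb{IR}}^{+}$ is $\overline{([x_1,x_2],0)}\bullet\overline{([z_1,z_2],0)}=\overline{([x_1z_1,x_2z_2],0)}$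 (it agrees there with the classical interval product). The quotients $x_1/x_2$ and $y_1/y_2$ in the hypothesis presuppose $x_2,y_2\neq 0$. Minimality of $c(\mathcal{R})$ is among all pairs $(\mathcal{Z},\mathcal{R})$ in $\overline{\mathbb{IR}}^{+}$ with $\mathcal{Y}=\mathcal{X}\bullet\mathcal{Z}+\mathcal{R}$ and $l(\mathcal{R})=0$.
   Formalization: Uniqueness of the pair is claimed only when x_1 ≠ 0 or y_1 = y_2, since it fails whenever x_1 = 0 and y_1 < y_2 (e.g. X=[0,1], Y=[1,2], Z=[z,1], R=[1,1], 0≤z≤1); in all cases the given pair is minimal and R is unique. *)

theory Defs
  imports Complex_Main "HOL-Library.Interval"
begin

abbreviation ivl :: "real \<Rightarrow> real \<Rightarrow> real interval" where
  "ivl a b \<equiv> Interval (a, b)"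

lemma lower_ivl [simp]: "a \<le> b \<Longrightarrow> lower (ivl a b) = a"
  and upper_ivl [simp]: "a \<le> b \<Longrightarrow> upper (ivl a b) = b"
  by (simp_all add: lower.rep_eq upper.rep_eq Interval_inverse)

lemma ivl_lower_upper [simp]: "ivl (lower X) (upper X) = X"
  by (simp add: interval_eq_iff)

definition ivl_rel :: "real interval \<times> real interval \<Rightarrow> real interval \<times> real interval \<Rightarrow> bool" where
  "ivl_rel = (\<lambda>(x, y) (z, t). x + t = y + z)"

quotient_type gen_ivl = "real interval \<times> real interval" / ivl_rel
proof (rule equivpI)
  show "reflp ivl_rel"
    by (auto simp: reflp_def ivl_rel_def add.commute)
  show "symp ivl_rel"
    by (auto simp: symp_def ivl_rel_def interval_eq_iff)
  show "transp ivl_rel"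
    by (fastforce simp: transp_def ivl_rel_def interval_eq_iff)
qed

lift_definition cls :: "real interval \<Rightarrow> real interval \<Rightarrow> gen_ivl" is Pair .

instantiation gen_ivl :: plus
begin

lift_definition plus_gen_ivl :: "gen_ivl \<Rightarrow> gen_ivl \<Rightarrow> gen_ivl"
  is "\<lambda>(x, y) (z, t). (x + z, y + t)"
  by (auto simp: ivl_rel_def interval_eq_iff)

instance ..

end

lemma cls_add: "cls x y + cls z t = cls (x + z) (y + t)"
  by transfer (simp add: ivl_rel_def interval_eq_iff)

lemma cls_eq_iff: "cls x y = cls z t \<longleftrightarrow> x + t = y + z"
  by transfer (simp add: ivl_rel_def)

definition gen_ivl_pos :: "gen_ivl set" where
  "gen_ivl_pos = {cls X 0 |X. 0 \<le> lower X}"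

text \<open>
  Multiples by nonnegative scalars, length, center and product are only defined on classes of
  the form \<open>cls X 0\<close> (for the product: with \<open>0 \<le> lower X\<close>), so they are all expressed through the
  representative \<open>X\<close>. It is unique because intervals are cancellative under addition;
  on other classes \<open>rep_ivl\<close> is unspecified.
\<close>

definition rep_ivl :: "gen_ivl \<Rightarrow> real interval" where
  "rep_ivl G = (THE X. G = cls X 0)"

lemma rep_ivl_cls [simp]: "rep_ivl (cls X 0) = X"
  by (auto simp: rep_ivl_def cls_eq_iff)

definition scale :: "real \<Rightarrow> gen_ivl \<Rightarrow> gen_ivl" where
  "scale \<alpha> G = (let X = rep_ivl G in cls (ivl (\<alpha> * lower X) (\<alpha> * upper X)) 0)"

definition len :: "gen_ivl \<Rightarrow> real" where
  "len G = (let X = rep_ivl G in upper X - lower X)"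

definition center :: "gen_ivl \<Rightarrow> real" where
  "center G = (let X = rep_ivl G in (lower X + upper X) / 2)"

definition gprod :: "gen_ivl \<Rightarrow> gen_ivl \<Rightarrow> gen_ivl"  (infixl \<open>\<bullet>\<close> 70) where
  "G \<bullet> H = (let X = rep_ivl G; Z = rep_ivl H
            in cls (ivl (lower X * lower Z) (upper X * upper Z)) 0)"

definition division_pair :: "gen_ivl \<Rightarrow> gen_ivl \<Rightarrow> gen_ivl \<Rightarrow> gen_ivl \<Rightarrow> bool" where
  "division_pair X Y Z R \<longleftrightarrow>
     Z \<in> gen_ivl_pos \<and> R \<in> gen_ivl_pos \<and> Y = X \<bullet> Z + R \<and> len R = 0"

definition min_division_pair :: "gen_ivl \<Rightarrow> gen_ivl \<Rightarrow> gen_ivl \<Rightarrow> gen_ivl \<Rightarrow> bool" where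
  "min_division_pair X Y Z R \<longleftrightarrow>
     division_pair X Y Z R \<and> (\<forall>Z' R'. division_pair X Y Z' R' \<longrightarrow> center R \<le> center R')"

text \<open>
  When the lower bound of \<open>X\<close> vanishes, the lower bound of \<open>Z\<close> does not influence \<open>X \<bullet> Z\<close>, so a
  minimal pair need not be unique; only its second component is. For instance, \<open>Z = [0, 1]\<close> and
  \<open>Z = [1, 1]\<close> both solve \<open>X = [0, 1]\<close>, \<open>Y = [1, 2]\<close> with \<open>R = [1, 1]\<close>.
\<close>

lemma min_division_pair_not_unique:
  defines "X \<equiv> cls (ivl 0 1) 0" and "Y \<equiv> cls (ivl 1 2) 0" and "R \<equiv> cls (ivl 1 1) 0"
  shows "min_division_pair X Y (cls (ivl 0 1) 0) R"
    and "min_division_pair X Y (cls (ivl 1 1) 0) R"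
    and "cls (ivl 0 1) 0 \<noteq> cls (ivl 1 1) 0"
proof -
  have pair: "division_pair X Y (cls (ivl z 1) 0) R" if "0 \<le> z" "z \<le> 1" for z
  proof -
    have "cls (ivl z 1) 0 \<in> gen_ivl_pos" "R \<in> gen_ivl_pos"
      using that unfolding gen_ivl_pos_def R_def
      by (auto intro: exI[of _ "ivl z 1"])
    then show ?thesis
      using that
      by (simp add: X_def Y_def R_def division_pair_def gprod_def len_def cls_add
          cls_eq_iff interval_eq_iff)
  qed
  have minimal: "center R \<le> center R'" if "division_pair X Y Z' R'" for Z' R'
  proof -
    obtain V W where "Z' = cls V 0" "0 \<le> lower V" "R' = cls W 0" "Y = X \<bullet> Z' + R'" "len R' = 0"
      using \<open>division_pair X Y Z' R'\<close> by (auto simp: division_pair_def gen_ivl_pos_def)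
    moreover have "0 \<le> upper V"
      using \<open>0 \<le> lower V\<close> lower_le_upper[of V] by linarith
    ultimately show ?thesis
      by (simp add: X_def Y_def R_def center_def len_def gprod_def cls_add cls_eq_iff
          interval_eq_iff)
  qed
  show "min_division_pair X Y (cls (ivl 0 1) 0) R" "min_division_pair X Y (cls (ivl 1 1) 0) R"
    using pair minimal by (auto simp: min_division_pair_def)
  show "cls (ivl 0 1) 0 \<noteq> cls (ivl 1 1) 0"
    by (simp add: cls_eq_iff interval_eq_iff)
qed

end

theory Submission
  imports Defs
begin

text \<open>
  A remainder of length 0 is a point \<open>[r, r]\<close>, so with \<open>\<Z> = [v1, v2]\<close> the division equation amounts
  to the two real equations \<open>y1 = x1 * v1 + r\<close> and \<open>y2 = x2 * v2 + r\<close>, and the center to be minimized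
  is \<open>r\<close> itself (lemma \<open>division_pair_iff\<close>). Since \<open>r = y2 - x2 * v2\<close> with \<open>x2 > 0\<close>, minimizing \<open>r\<close>
  means maximizing \<open>v2\<close>. Subtracting the equations and using \<open>v1 \<le> v2\<close> gives
  \<open>y2 - y1 = x2 * v2 - x1 * v1 \<ge> (x2 - x1) * v2\<close>, which bounds \<open>v2\<close> by the slope
  \<open>(y2 - y1) / (x2 - x1)\<close>; the point interval at this slope attains the bound. The hypothesis
  \<open>x1 / x2 < y1 / y2\<close> says that the resulting remainder is positive, and because \<open>y1 \<le> y2\<close> it also
  forces \<open>x1 < x2\<close>.

  A minimal pair therefore has the prescribed \<open>r\<close> and \<open>v2\<close>. The value of \<open>v1\<close> is then determined
  by \<open>x1 * v1 = y1 - r\<close> if \<open>x1 \<noteq> 0\<close>, and by \<open>0 \<le> v1 \<le> v2 = 0\<close> if \<open>y1 = y2\<close>.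
\<close>

lemma center_cls_ivl: "a \<le> b \<Longrightarrow> center (cls (ivl a b) 0) = (a + b) / 2"
  by (simp add: center_def)

lemma scale_unit: "scale a (cls (ivl 1 1) 0) = cls (ivl a a) 0"
  by (simp add: scale_def)

lemma cls_ivl_mem_gen_ivl_pos_iff:
  assumes "a \<le> b"
  shows "cls (ivl a b) 0 \<in> gen_ivl_pos \<longleftrightarrow> 0 \<le> a"
  using assms by (auto simp: gen_ivl_pos_def cls_eq_iff)

lemma gen_ivl_pos_cases:
  assumes "G \<in> gen_ivl_pos"
  obtains a b where "G = cls (ivl a b) 0" "0 \<le> a" "a \<le> b"
proof -
  obtain V where "G = cls V 0" "0 \<le> lower V"
    using assms by (auto simp: gen_ivl_pos_def)
  then show ?thesis
    using that[of "lower V" "upper V"] by simp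
qed

text \<open>
  All the classes involved have the form \<open>cls V 0\<close>, on which the operations act bound by bound;
  nonnegativity keeps the bounds of the product in order.
\<close>

lemma division_pair_iff:
  assumes "0 \<le> x1" and "x1 \<le> x2" and "y1 \<le> y2"
  shows "division_pair (cls (ivl x1 x2) 0) (cls (ivl y1 y2) 0) Z R \<longleftrightarrow>
    (\<exists>v1 v2 r. Z = cls (ivl v1 v2) 0 \<and> R = cls (ivl r r) 0 \<and> 0 \<le> v1 \<and> v1 \<le> v2 \<and> 0 \<le> r \<and>
      y1 = x1 * v1 + r \<and> y2 = x2 * v2 + r)"
    (is "?lhs \<longleftrightarrow> ?rhs")
proof -
  have bounds: "cls (ivl y1 y2) 0 = cls (ivl x1 x2) 0 \<bullet> cls (ivl v1 v2) 0 + cls (ivl r r) 0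
      \<longleftrightarrow> y1 = x1 * v1 + r \<and> y2 = x2 * v2 + r"
    if "0 \<le> v1" "v1 \<le> v2" for v1 v2 r
  proof -
    have "x1 * v1 \<le> x2 * v2"
      using assms that by (intro mult_mono) auto
    then show ?thesis
      using assms that by (simp add: gprod_def cls_add cls_eq_iff interval_eq_iff)
  qed
  show ?thesis
  proof
    assume pair: ?lhs
    obtain v1 v2 where Z: "Z = cls (ivl v1 v2) 0" "0 \<le> v1" "v1 \<le> v2"
      using pair gen_ivl_pos_cases by (auto simp: division_pair_def)
    obtain r s where R: "R = cls (ivl r s) 0" "0 \<le> r" "r \<le> s"
      using pair gen_ivl_pos_cases by (auto simp: division_pair_def)
    have "s = r"
      using pair R by (simp add: division_pair_def len_def)
    then show ?rhs
      using pair Z R bounds[of v1 v2 r] by (auto simp: division_pair_def)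
  next
    assume ?rhs
    then show ?lhs
      using bounds by (auto simp: division_pair_def len_def cls_ivl_mem_gen_ivl_pos_iff)
  qed
qed

lemma quotient_less_imp:
  fixes x1 x2 y1 y2 :: real
  assumes "0 < x2" and "0 < y2" and "y1 \<le> y2" and "x1 / x2 < y1 / y2"
  shows "x1 * y2 < x2 * y1" and "x1 < x2"
proof -
  show "x1 * y2 < x2 * y1"
    using assms by (simp add: field_simps)
  have "y1 / y2 \<le> 1"
    using assms by simp
  then have "x1 / x2 < 1"
    using assms by linarith
  then show "x1 < x2"
    using assms by simp
qed

lemma upper_quotient_le_slope:
  fixes x1 x2 y1 y2 v1 v2 r :: real
  assumes "0 \<le> x1" and "x1 < x2" and "v1 \<le> v2"
    and "y1 = x1 * v1 + r" and "y2 = x2 * v2 + r"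
  shows "v2 \<le> (y2 - y1) / (x2 - x1)"
proof -
  have "x1 * v1 \<le> x1 * v2"
    using assms by (intro mult_left_mono)
  then show ?thesis
    using assms by (simp add: field_simps)
qed

lemma remainder_eq:
  fixes x1 x2 y1 y2 :: real
  assumes "x1 < x2"
  defines "z \<equiv> (y2 - y1) / (x2 - x1)" and "\<rho> \<equiv> (x2 * y1 - x1 * y2) / (x2 - x1)"
  shows "y1 = x1 * z + \<rho>" and "y2 = x2 * z + \<rho>"
  using assms(1) unfolding z_def \<rho>_def
  by (simp_all add: divide_simps) (simp_all add: algebra_simps)

theorem theorem24:
  fixes x1 x2 y1 y2 :: real and X Y Z R :: gen_ivl
  assumes "x1 \<le> x2" and "y1 \<le> y2"
    and "X = cls (ivl x1 x2) 0" and "Y = cls (ivl y1 y2) 0"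
    and "X \<in> gen_ivl_pos" and "Y \<in> gen_ivl_pos"
    and "x2 \<noteq> 0" and "y2 \<noteq> 0"
    and "x1 / x2 < y1 / y2"
    and "Z = scale ((y2 - y1) / (x2 - x1)) (cls (ivl 1 1) 0)"
    and "R = scale ((x2 * y1 - x1 * y2) / (x2 - x1)) (cls (ivl 1 1) 0)"
  shows "min_division_pair X Y Z R
    \<and> (\<forall>Z' R'. min_division_pair X Y Z' R' \<longrightarrow> R' = R)
    \<and> (x1 \<noteq> 0 \<or> y1 = y2 \<longrightarrow> (\<exists>!(Z', R'). min_division_pair X Y Z' R'))"
proof -
  define z where "z = (y2 - y1) / (x2 - x1)"
  define \<rho> where "\<rho> = (x2 * y1 - x1 * y2) / (x2 - x1)"
  have Z: "Z = cls (ivl z z) 0" and R: "R = cls (ivl \<rho> \<rho>) 0"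
    using assms(10,11) by (simp_all add: scale_unit z_def \<rho>_def)
  have "0 \<le> x1" "0 \<le> y1"
    using assms(1-6) by (simp_all add: cls_ivl_mem_gen_ivl_pos_iff)
  then have "0 < x2" "0 < y2"
    using assms(1,2,7,8) by auto
  note quotient = quotient_less_imp[OF this assms(2,9)]
  have "0 \<le> z" "0 \<le> \<rho>"
    using quotient assms(2) by (simp_all add: z_def \<rho>_def)
  have y1: "y1 = x1 * z + \<rho>" and y2: "y2 = x2 * z + \<rho>"
    using remainder_eq[OF quotient(2)] by (auto simp: z_def \<rho>_def)
  note iff = division_pair_iff[OF \<open>0 \<le> x1\<close> assms(1,2), folded assms(3,4)]

  have pair: "division_pair X Y Z R"
    using Z R \<open>0 \<le> z\<close> \<open>0 \<le> \<rho>\<close> y1 y2 unfolding iff by blast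
  have upper_le: "v2 \<le> z" if "v1 \<le> v2" "y1 = x1 * v1 + r" "y2 = x2 * v2 + r" for v1 v2 r
    using upper_quotient_le_slope[OF \<open>0 \<le> x1\<close> quotient(2) that] by (simp add: z_def)
  have "center R \<le> center R'" if pair': "division_pair X Y Z' R'" for Z' R'
  proof -
    obtain v1 v2 r where "R' = cls (ivl r r) 0" "v1 \<le> v2" "y1 = x1 * v1 + r" "y2 = x2 * v2 + r"
      using pair' unfolding iff by blast
    moreover from this have "x2 * v2 \<le> x2 * z"
      using upper_le \<open>0 < x2\<close> by simp
    ultimately show ?thesis
      using R y2 by (simp add: center_cls_ivl)
  qed
  then have minimal: "min_division_pair X Y Z R"
    using pair by (simp add: min_division_pair_def)

  have minimal_cases: "\<exists>v1. Z' = cls (ivl v1 z) 0 \<and> R' = R \<and> 0 \<le> v1 \<and> v1 \<le> z \<and> x1 * v1 = x1 * z"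
    if min': "min_division_pair X Y Z' R'" for Z' R'
  proof -
    obtain v1 v2 r where v: "Z' = cls (ivl v1 v2) 0" "R' = cls (ivl r r) 0" "0 \<le> v1" "v1 \<le> v2"
        "y1 = x1 * v1 + r" "y2 = x2 * v2 + r"
      using min' unfolding min_division_pair_def iff by blast
    have "center R' \<le> center R"
      using min' pair by (simp add: min_division_pair_def)
    then have "r \<le> \<rho>"
      using v(2) R by (simp add: center_cls_ivl)
    then have "x2 * z \<le> x2 * v2"
      using v(6) y2 by linarith
    then have "v2 = z"
      using upper_le[OF v(4-6)] \<open>0 < x2\<close> by simp
    moreover from this have "r = \<rho>"
      using v(6) y2 by simp
    ultimately show ?thesis
      using v R y1 by auto
  qed
  have unique: "Z' = Z \<and> R' = R"
    if min': "min_division_pair X Y Z' R'" and "x1 \<noteq> 0 \<or> y1 = y2" for Z' R'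
  proof -
    obtain v1 where v1: "Z' = cls (ivl v1 z) 0" "R' = R" "0 \<le> v1" "v1 \<le> z" "x1 * v1 = x1 * z"
      using minimal_cases[OF min'] by blast
    have "v1 = z"
    proof (cases "x1 = 0")
      case True
      then have "z = 0"
        using that(2) by (simp add: z_def)
      then show ?thesis
        using v1 by simp
    qed (use v1 in simp)
    then show ?thesis
      using v1 Z by simp
  qed
  show ?thesis
  proof (intro conjI allI impI)
    show "min_division_pair X Y Z R"
      by (rule minimal)
    show "R' = R" if "min_division_pair X Y Z' R'" for Z' R'
      using minimal_cases[OF that] by blast
    show "\<exists>!(Z', R'). min_division_pair X Y Z' R'" if "x1 \<noteq> 0 \<or> y1 = y2"
    proof (rule ex1I[of _ "(Z, R)"])
      show "case (Z, R) of (Z', R') \<Rightarrow> min_division_pair X Y Z' R'"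
        using minimal by simp
      show "p = (Z, R)" if "case p of (Z', R') \<Rightarrow> min_division_pair X Y Z' R'" for p
        using that unique[OF _ \<open>x1 \<noteq> 0 \<or> y1 = y2\<close>, of "fst p" "snd p"]
        by (simp add: case_prod_beta prod_eq_iff)
    qed
  qed
qed

end
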